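(* Let $P,Q\in\mathbb{Z}$ with $PQ=0$, let $p$ be a prime and let $r\geq 1$ be an integer. Then \[ \mathcal{L}(P,Q,p^{-r}) = \begin{cases} \{0\} & \text{if } P\neq 0,\ Q=0,\ p\nmid P,\\ S_{\lceil r/\nu_p(P)\rceil+1} & \text{if } P\neq 0,\ Q=0,\ p\mid P,\\ \langle 2\rangle & \text{if } P=0,\ Q\neq 0,\ p\nmid Q,\\ \langle 2,\ 2\lceil r/\nu_p(Q)\rceil+1\rangle & \text{if } P=0,\ Q\neq 0,\ p\mid Q,\\ S_2 & \text{if } P=Q=0. \end{cases} \]
   Context: $\mathbb{N}=\{0,1,2,\ldots\}$. For $P,Q\in\mathbb{Z}$, the Lucas sequence $U_n=U_n(P,Q)$ is defined by $U_0=0$, $U_1=1$, $U_{n+2}=PU_{n+1}-QU_n$. For $R\in\mathbb{Q}$, $\mathcal{L}(P,Q,R)=\{n\in\mathbb{N} : U_nR\in\mathbb{Z}\}$; thus $\mathcal{L}(P,Q,p^{-r})=\{n\in\mathbb{N}:\nu_p(U_n)\geq r\}$, where $\nu_p$ is the $p$-adic valuation ($\nu_p(0)=\infty$). $\langle\cdot\rangle$ denotes the additive subsemigroup of $\mathbb{N}$ generated by the given elements (including $0$). For $m\geq 1$, $S_m=\{0,m,m+1,m+2,\ldots\}$. *)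

theory Defs
  imports Complex_Main "HOL-Computational_Algebra.Primes"
begin

fun lucas_U :: "int \<Rightarrow> int \<Rightarrow> nat \<Rightarrow> int" where
  "lucas_U P Q 0 = 0"
| "lucas_U P Q (Suc 0) = 1"
| "lucas_U P Q (Suc (Suc n)) = P * lucas_U P Q (Suc n) - Q * lucas_U P Q n"

definition lucas_L :: "int \<Rightarrow> int \<Rightarrow> rat \<Rightarrow> nat set" where
  "lucas_L P Q R = {n. of_int (lucas_U P Q n) * R \<in> \<int>}"

text \<open>The generated subsemigroup contains 0 by convention, i.e. it is the generated submonoid.\<close>

inductive_set generated_semigroup :: "nat set \<Rightarrow> nat set" for A :: "nat set" where
  zero: "0 \<in> generated_semigroup A"
| gen: "a \<in> A \<Longrightarrow> a \<in> generated_semigroup A"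
| add: "x \<in> generated_semigroup A \<Longrightarrow> y \<in> generated_semigroup A \<Longrightarrow> x + y \<in> generated_semigroup A"

definition S_from :: "nat \<Rightarrow> nat set" where
  "S_from m = insert 0 {m..}"

end

theory Submission
  imports Defs
begin

text \<open>If \<open>Q = 0\<close> then \<open>U\<^sub>n\<^sub>+\<^sub>1 = P\<^sup>n\<close>; if \<open>P = 0\<close> then the terms of even index vanish and
  \<open>U\<^sub>2\<^sub>k\<^sub>+\<^sub>1 = (-Q)\<^sup>k\<close>. So everything reduces to when a prime power \<open>p\<^sup>r\<close> divides \<open>a\<^sup>k\<close>, which
  happens iff \<open>r \<le> k \<nu>\<^sub>p(a)\<close>.\<close>

lemma lucas_U_0_right: "lucas_U P 0 (Suc n) = P ^ n"
  by (induction n) auto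

lemma lucas_U_0_left_even: "lucas_U 0 Q (2 * k) = 0"
  by (induction k) auto

lemma lucas_U_0_left_odd: "lucas_U 0 Q (Suc (2 * k)) = (- Q) ^ k"
  by (induction k) auto

text \<open>The product is the quotient of \<open>a\<close> by \<open>int p ^ r\<close>. Positivity
  of \<open>p\<close> excludes a zero denominator, for which HOL division would give the integer
  0.\<close>

lemma of_int_mult_powi_minus_in_Ints_iff:
  assumes "p > 0"
  shows "(of_int a * of_nat p powi (- int r) :: rat) \<in> \<int> \<longleftrightarrow> int p ^ r dvd a"
proof -
  have "of_int a * of_nat p powi (- int r) = (of_int a / of_int (int p ^ r) :: rat)"
    by (simp add: power_int_minus field_simps)
  then show ?thesis
    using assms by (simp only: of_int_div_of_int_in_Ints_iff) simp
qed

lemma lucas_L_prime_power: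
  assumes "prime p"
  shows "lucas_L P Q (of_nat p powi (- int r)) = {n. int p ^ r dvd lucas_U P Q n}"
  using assms by (simp add: lucas_L_def of_int_mult_powi_minus_in_Ints_iff prime_gt_0_nat)

text \<open>The valuation of \<open>a ^ k\<close> is \<open>k\<close> times that of
  \<open>a\<close>, so the condition is a linear inequality in \<open>k\<close>; its least solution
  is the ceiling.\<close>

lemma prime_power_dvd_power_iff:
  fixes a :: int
  assumes "prime p" "a \<noteq> 0" "int p dvd a"
  shows "int p ^ r dvd a ^ k \<longleftrightarrow> nat \<lceil>real r / real (multiplicity (int p) a)\<rceil> \<le> k"
proof -
  have p: "prime (int p)"
    using assms(1) by simp
  then have unit: "\<not> is_unit (int p)"
    using not_prime_unit by blast
  \<comment> \<open>This is where \<open>int p dvd a\<close> enters: it permits dividing the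
    inequality by the valuation.\<close>
  have v: "multiplicity (int p) a > 0"
    using assms unit by (simp add: multiplicity_gt_zero_iff)
  have "int p ^ r dvd a ^ k \<longleftrightarrow> r \<le> k * multiplicity (int p) a"
    using assms p unit
    by (simp add: power_dvd_iff_le_multiplicity prime_elem_multiplicity_power_distrib)
  also have "\<dots> \<longleftrightarrow> real r \<le> real k * real (multiplicity (int p) a)"
    by (metis of_nat_le_iff of_nat_mult)
  also have "\<dots> \<longleftrightarrow> nat \<lceil>real r / real (multiplicity (int p) a)\<rceil> \<le> k"
    using v by (simp add: ceiling_le_iff divide_le_eq nat_le_iff)
  finally show ?thesis .
qed

lemma prime_power_not_dvd_power:
  fixes a :: int
  assumes "prime p" "r \<ge> 1" "\<not> int p dvd a"
  shows "\<not> int p ^ r dvd a ^ k"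
proof
  assume "int p ^ r dvd a ^ k"
  moreover have "int p dvd int p ^ r"
    using assms(2) by (simp add: dvd_power)
  ultimately have "int p dvd a ^ k"
    using dvd_trans by blast
  then show False
    using assms by (meson prime_dvd_power prime_nat_int_transfer)
qed

lemma double_in_generated_semigroup:
  assumes "2 \<in> A"
  shows "2 * k \<in> generated_semigroup A"
proof (induction k)
  case 0
  show ?case by (simp add: generated_semigroup.zero)
next
  case (Suc k)
  show ?case
    using generated_semigroup.add[OF generated_semigroup.gen[OF assms] Suc.IH] by simp
qed

lemma generated_semigroup_2: "generated_semigroup {2} = {n. even n}"
proof (intro equalityI subsetI)
  fix n assume "n \<in> generated_semigroup {2}"
  then show "n \<in> {n. even n}" by induction auto
qed (auto simp: double_in_generated_semigroup elim: evenE)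

text \<open>An odd sum must use the odd generator, hence is at least \<open>2 * c + 1\<close>;
  conversely, an odd number above this bound differs from it by a multiple of 2.\<close>

lemma generated_semigroup_2_odd:
  "generated_semigroup {2, 2 * c + 1} = {n. even n \<or> 2 * c + 1 \<le> n}"
proof (intro equalityI subsetI)
  fix n assume "n \<in> generated_semigroup {2, 2 * c + 1}"
  then show "n \<in> {n. even n \<or> 2 * c + 1 \<le> n}" by induction auto
next
  fix n assume n: "n \<in> {n. even n \<or> 2 * c + 1 \<le> n}"
  show "n \<in> generated_semigroup {2, 2 * c + 1}"
  proof (cases "even n")
    case True
    then show ?thesis by (auto simp: double_in_generated_semigroup elim: evenE)
  next
    case False
    then obtain k where k: "n = 2 * k + 1" by (rule oddE)
    with n have "c \<le> k" by simp
    then have "n = (2 * c + 1) + 2 * (k - c)" using k by simp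
    moreover have "(2 * c + 1) + 2 * (k - c) \<in> generated_semigroup {2, 2 * c + 1}"
      by (intro generated_semigroup.add double_in_generated_semigroup generated_semigroup.gen) auto
    ultimately show ?thesis by (simp only:)
  qed
qed

lemma image_Suc_atLeast: "Suc ` {c..} = {Suc c..}"
  by (auto simp: image_iff dest: Suc_le_D)

text \<open>Index 0 always belongs because the term there is 0. The exponent of \<open>P\<close>
  lags the index by one, which is the source of the \<open>+ 1\<close> in the final formula.\<close>

lemma lucas_L_0_right:
  assumes "prime p"
  shows "lucas_L P 0 (of_nat p powi (- int r)) = insert 0 (Suc ` {k. int p ^ r dvd P ^ k})"
proof (rule set_eqI)
  fix n show "n \<in> lucas_L P 0 (of_nat p powi (- int r)) \<longleftrightarrow>
      n \<in> insert 0 (Suc ` {k. int p ^ r dvd P ^ k})"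
    by (cases n) (auto simp: lucas_L_prime_power[OF assms] lucas_U_0_right)
qed

lemma lucas_L_0_left:
  assumes "prime p"
  shows "lucas_L 0 Q (of_nat p powi (- int r)) =
    {n. even n \<or> int p ^ r dvd Q ^ (n div 2)}"
proof -
  have "int p ^ r dvd lucas_U 0 Q n \<longleftrightarrow> even n \<or> int p ^ r dvd Q ^ (n div 2)" for n
  proof (cases "even n")
    case True
    then show ?thesis by (auto simp: lucas_U_0_left_even elim: evenE)
  next
    case False
    then obtain k where "n = Suc (2 * k)" by (metis oddE Suc_eq_plus1)
    then show ?thesis
      \<comment> \<open>The parity of \<open>k\<close> fixes the sign of \<open>(- Q) ^ k\<close>,
        which does not affect divisibility.\<close>
      by (cases "even k") (simp_all del: lucas_U.simps add: lucas_U_0_left_odd)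
  qed
  then show ?thesis by (simp add: lucas_L_prime_power[OF assms])
qed

theorem theorem3p1:
  fixes P Q :: int and p r :: nat
  assumes "P * Q = 0" and "prime p" and "r \<ge> 1"
  shows "lucas_L P Q (of_nat p powi (- int r)) =
    (if P \<noteq> 0 \<and> Q = 0 \<and> \<not> int p dvd P then {0}
     else if P \<noteq> 0 \<and> Q = 0 \<and> int p dvd P then
       S_from (nat \<lceil>real r / real (multiplicity (int p) P)\<rceil> + 1)
     else if P = 0 \<and> Q \<noteq> 0 \<and> \<not> int p dvd Q then generated_semigroup {2}
     else if P = 0 \<and> Q \<noteq> 0 \<and> int p dvd Q then
       generated_semigroup {2, 2 * nat \<lceil>real r / real (multiplicity (int p) Q)\<rceil> + 1}
     else S_from 2)"
proof -
  consider "P \<noteq> 0" "Q = 0" "\<not> int p dvd P" | "P \<noteq> 0" "Q = 0" "int p dvd P"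
    | "P = 0" "Q \<noteq> 0" "\<not> int p dvd Q" | "P = 0" "Q \<noteq> 0" "int p dvd Q" | "P = 0" "Q = 0"
    using assms(1) by auto
  then show ?thesis
  proof cases
    case 1
    \<comment> \<open>No power of \<open>P\<close> is divisible by \<open>int p ^ r\<close>, so the
      image under \<open>Suc\<close> is empty and only 0 remains.\<close>
    then show ?thesis
      by (simp add: lucas_L_0_right prime_power_not_dvd_power[OF assms(2,3)] assms(2))
  next
    case 2
    define c where "c = nat \<lceil>real r / real (multiplicity (int p) P)\<rceil>"
    have "{k. int p ^ r dvd P ^ k} = {c..}"
      using 2 assms by (auto simp: prime_power_dvd_power_iff c_def)
    then have "lucas_L P Q (of_nat p powi (- int r)) = S_from (c + 1)"
      using 2 by (simp add: lucas_L_0_right assms S_from_def image_Suc_atLeast)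
    then show ?thesis using 2 by (simp add: c_def)
  next
    case 3
    then show ?thesis
      by (simp add: lucas_L_0_left prime_power_not_dvd_power[OF assms(2,3)] assms(2)
          generated_semigroup_2)
  next
    case 4
    define c where "c = nat \<lceil>real r / real (multiplicity (int p) Q)\<rceil>"
    have "int p ^ r dvd Q ^ k \<longleftrightarrow> c \<le> k" for k
      unfolding c_def using 4 assms by (intro prime_power_dvd_power_iff) auto
    then have "lucas_L P Q (of_nat p powi (- int r)) = {n. even n \<or> c \<le> n div 2}"
      using 4 by (simp add: lucas_L_0_left assms)
    \<comment> \<open>For odd \<open>n = 2 * k + 1\<close>, both conditions say
      \<open>c \<le> k\<close>.\<close>
    also have "\<dots> = {n. even n \<or> 2 * c + 1 \<le> n}"
      by (intro Collect_cong) presburger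
    also have "\<dots> = generated_semigroup {2, 2 * c + 1}"
      by (simp only: generated_semigroup_2_odd)
    finally show ?thesis using 4 by (simp add: c_def)
  next
    case 5
    \<comment> \<open>Since \<open>0 ^ 0 = 1\<close> and \<open>r \<ge> 1\<close>, exactly
      \<open>k = 0\<close> fails. After the shift by one, index 1 is the only one missing.\<close>
    have "int p ^ r dvd 0 ^ k \<longleftrightarrow> 1 \<le> k" for k
      using assms by (cases k) (auto simp: zdvd1_eq is_unit_power_iff)
    then have "{k. int p ^ r dvd 0 ^ k} = {1..}" by auto
    then show ?thesis
      using 5 by (simp add: lucas_L_0_right assms S_from_def image_Suc_atLeast numeral_2_eq_2)
  qed
qed

end
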